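(* Let $M$ be a compact metric space with finite Nagata dimension. Then $M$ admits an ACUG $\ell_2$-structure. Moreover, the operators $\Phi_H$ in the definition of the ACUG $\ell_2$-structure may be chosen with range contained in $\operatorname{Lip}(M,\ell_2)\subset\mathcal C_b(M,\ell_2)$, the set of Lipschitz maps from $M$ to $\ell_2$ (where $\ell_2^*$ is identified with $\ell_2$).
   Context: Nagata dimension. $M$ has finite Nagata dimension if there are an integer $d\ge 0$ and $\gamma>0$ such that for every $s>0$ there is a cover $\mathcal C$ of $M$ by sets of diameter at most $\gamma s$ such that every $A\subset M$ with $\operatorname{diam}(A)<s$ meets at most $d+1$ members of $\mathcal C$. Upper gradients. An upper gradient of $f\colon M\to\mathbb R$ is a Borel function $g\colon M\to[0,\infty]$ such that for all $p,q\in M$ and every $1$-Lipschitz curve $\gamma\colon[0,\ell]\to M$ with $\gamma(0)=p$, $\gamma(\ell)=q$, one has $|f(q)-f(p)|\le\int_0^\ell g(\gamma(s))\,ds$. ACUG structure. Let $M$ be a complete metric space, $X$ a (real) Banach space, $\operatorname{Lip}(M)$ the space of real-valued Lipschitz functions on $M$ with seminorm $\|f\|_L$ = best Lipschitz constant, and $\mathcal C_b(M,X^* )$ the Banach space of bounded continuous maps $M\to X^*$ with the sup norm. $M$ has an approximate continuous upper gradient $X$-structure (ACUG $X$-structure) if there is $C>0$ such that for every $\varepsilon>0$ there exist a (not necessarily closed) linear subspace $H\subset\operatorname{Lip}(M)$ and a linear operator $\Phi_H\colon H\to\mathcal C_b(M,X^* )$ with: (1) for every $f\in\operatorname{Lip}(M)$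 with $\|f\|_L\le 1$ there is $g\in H$ with $\|g\|_L\le C$, $\|\Phi_H g\|_\infty\le C$ and $\|f-g\|_\infty\le\varepsilon$; (2) for every $f\in H$, the function $x\mapsto\|(\Phi_H f)(x)\|_{X^*}$ is an upper gradient of $f$. *)

theory Defs
  imports "HOL-Analysis.Analysis"
begin

section \<open>The real Hilbert space of square-summable sequences\<close>

lemma summable_mult_of_squares:
  fixes x y :: "nat \<Rightarrow> real"
  assumes "summable (\<lambda>n. (x n)\<^sup>2)" "summable (\<lambda>n. (y n)\<^sup>2)"
  shows "summable (\<lambda>n. x n * y n)"
proof (rule summable_comparison_test)
  show "summable (\<lambda>n. (x n)\<^sup>2 + (y n)\<^sup>2)"
    using assms by (rule summable_add)
  have "norm (x n * y n) \<le> (x n)\<^sup>2 + (y n)\<^sup>2" for n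
  proof -
    have "2 * (\<bar>x n\<bar> * \<bar>y n\<bar>) \<le> (x n)\<^sup>2 + (y n)\<^sup>2"
      using sum_squares_bound[of "\<bar>x n\<bar>" "\<bar>y n\<bar>"] by (simp add: mult.assoc)
    moreover have "0 \<le> \<bar>x n\<bar> * \<bar>y n\<bar>" by simp
    ultimately show ?thesis unfolding real_norm_def abs_mult by linarith
  qed
  then show "\<exists>N. \<forall>n\<ge>N. norm (x n * y n) \<le> (x n)\<^sup>2 + (y n)\<^sup>2" by blast
qed

lemma summable_square_add:
  fixes x y :: "nat \<Rightarrow> real"
  assumes "summable (\<lambda>n. (x n)\<^sup>2)" "summable (\<lambda>n. (y n)\<^sup>2)"
  shows "summable (\<lambda>n. (x n + y n)\<^sup>2)"
proof -
  have "summable (\<lambda>n. (x n)\<^sup>2 + (y n)\<^sup>2 + 2 * (x n * y n))"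
    using assms by (intro summable_add summable_mult summable_mult_of_squares)
  then show ?thesis by (simp add: power2_sum mult.assoc)
qed

typedef ell2 = "{x :: nat \<Rightarrow> real. summable (\<lambda>n. (x n)\<^sup>2)}"
  morphisms ell2_nth Abs_ell2
  by (rule exI[of _ "\<lambda>_. 0"]) simp

setup_lifting type_definition_ell2

lemma summable_ell2: "summable (\<lambda>n. (ell2_nth x n)\<^sup>2)"
  using ell2_nth[of x] by simp

instantiation ell2 :: real_inner
begin

lift_definition zero_ell2 :: ell2 is "\<lambda>_. 0" by simp

lift_definition plus_ell2 :: "ell2 \<Rightarrow> ell2 \<Rightarrow> ell2" is "\<lambda>x y n. x n + y n"
  by (rule summable_square_add)

lift_definition uminus_ell2 :: "ell2 \<Rightarrow> ell2" is "\<lambda>x n. - x n" by simp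

lift_definition minus_ell2 :: "ell2 \<Rightarrow> ell2 \<Rightarrow> ell2" is "\<lambda>x y n. x n - y n"
  using summable_square_add[where y = "\<lambda>n. - y n" for y] by simp

lift_definition scaleR_ell2 :: "real \<Rightarrow> ell2 \<Rightarrow> ell2" is "\<lambda>c x n. c * x n"
  by (simp add: power_mult_distrib summable_mult)

definition inner_ell2 :: "ell2 \<Rightarrow> ell2 \<Rightarrow> real"
  where "inner_ell2 x y = (\<Sum>n. ell2_nth x n * ell2_nth y n)"

definition norm_ell2 :: "ell2 \<Rightarrow> real"
  where "norm_ell2 x = sqrt (inner x x)"

definition sgn_ell2 :: "ell2 \<Rightarrow> ell2"
  where "sgn_ell2 x = scaleR (inverse (norm x)) x"

definition dist_ell2 :: "ell2 \<Rightarrow> ell2 \<Rightarrow> real"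
  where "dist_ell2 x y = norm (x - y)"

definition uniformity_ell2 :: "(ell2 \<times> ell2) filter"
  where "uniformity_ell2 = (INF e\<in>{0<..}. principal {(x, y). dist x y < e})"

definition open_ell2 :: "ell2 set \<Rightarrow> bool"
  where "open_ell2 U = (\<forall>x\<in>U. \<forall>\<^sub>F (x', y) in uniformity. x' = x \<longrightarrow> y \<in> U)"

instance
proof
  fix x y z :: ell2 and a b :: real
  have sm: "summable (\<lambda>n. ell2_nth u n * ell2_nth v n)" for u v
    by (intro summable_mult_of_squares summable_ell2)
  show "x + y + z = x + (y + z)" by transfer (simp add: algebra_simps)
  show "x + y = y + x" by transfer (simp add: algebra_simps)
  show "0 + x = x" by transfer simp
  show "- x + x = 0" by transfer simp
  show "x - y = x + - y" by transfer simp
  show "a *\<^sub>R (x + y) = a *\<^sub>R x + a *\<^sub>R y" by transfer (simp add: algebra_simps)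
  show "(a + b) *\<^sub>R x = a *\<^sub>R x + b *\<^sub>R x" by transfer (simp add: algebra_simps)
  show "a *\<^sub>R b *\<^sub>R x = (a * b) *\<^sub>R x" by transfer (simp add: algebra_simps)
  show "1 *\<^sub>R x = x" by transfer simp
  show "dist x y = norm (x - y)" by (rule dist_ell2_def)
  show "sgn x = scaleR (inverse (norm x)) x" by (rule sgn_ell2_def)
  show "uniformity = (INF e\<in>{0<..}. principal {(x, y :: ell2). dist x y < e})"
    by (rule uniformity_ell2_def)
  show "open U = (\<forall>x\<in>U. \<forall>\<^sub>F (x', y) in uniformity. x' = x \<longrightarrow> y \<in> U)" for U :: "ell2 set"
    by (rule open_ell2_def)
  show "inner x y = inner y x" by (simp add: inner_ell2_def mult.commute)
  show "inner (x + y) z = inner x z + inner y z"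
    using suminf_add[OF sm sm, of x z y z]
    by (simp add: inner_ell2_def plus_ell2.rep_eq algebra_simps)
  show "inner (a *\<^sub>R x) y = a * inner x y"
    using suminf_mult[OF sm, of a x y]
    by (simp add: inner_ell2_def scaleR_ell2.rep_eq algebra_simps)
  show "0 \<le> inner x x"
    unfolding inner_ell2_def by (intro suminf_nonneg sm) simp
  show "inner x x = 0 \<longleftrightarrow> x = 0"
  proof
    assume "inner x x = 0"
    then have "\<forall>n. ell2_nth x n * ell2_nth x n = 0"
      unfolding inner_ell2_def by (subst (asm) suminf_eq_zero_iff[OF sm]) auto
    then show "x = 0" by transfer auto
  qed (simp add: inner_ell2_def zero_ell2.rep_eq)
  show "norm x = sqrt (inner x x)" by (rule norm_ell2_def)
qed

end

lemma norm_ell2_eq: "norm (x :: ell2) = sqrt (\<Sum>n. (ell2_nth x n)\<^sup>2)"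
  by (simp add: norm_ell2_def inner_ell2_def power2_eq_square)

lemma sum_squares_le_norm_ell2: "(\<Sum>n<k. (ell2_nth x n)\<^sup>2) \<le> (norm x)\<^sup>2"
  by (simp add: norm_ell2_eq suminf_nonneg summable_ell2 sum_le_suminf)

lemma norm_ell2_leI:
  assumes "0 \<le> e" "\<And>k. (\<Sum>n<k. (ell2_nth x n)\<^sup>2) \<le> e\<^sup>2"
  shows "norm x \<le> e"
proof -
  have "(\<Sum>n. (ell2_nth x n)\<^sup>2) \<le> e\<^sup>2"
    by (rule suminf_le_const[OF summable_ell2 assms(2)])
  then show ?thesis
    unfolding norm_ell2_eq using assms(1) by (rule real_le_lsqrt[rotated])
qed

lemma abs_ell2_nth_le_norm: "\<bar>ell2_nth x n\<bar> \<le> norm x"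
proof -
  have "(ell2_nth x n)\<^sup>2 \<le> (\<Sum>i<Suc n. (ell2_nth x i)\<^sup>2)"
    by (simp add: sum_nonneg)
  also have "\<dots> \<le> (norm x)\<^sup>2" by (rule sum_squares_le_norm_ell2)
  finally show ?thesis using abs_le_square_iff[of "ell2_nth x n" "norm x"] by simp
qed

instance ell2 :: banach
proof
  fix X :: "nat \<Rightarrow> ell2"
  assume X: "Cauchy X"
  have "convergent (\<lambda>m. ell2_nth (X m) n)" for n
  proof (rule Cauchy_convergent, rule metric_CauchyI)
    fix e :: real assume "0 < e"
    then obtain N where N: "\<And>i j. i \<ge> N \<Longrightarrow> j \<ge> N \<Longrightarrow> dist (X i) (X j) < e"
      using metric_CauchyD[OF X] by blast
    show "\<exists>N. \<forall>i\<ge>N. \<forall>j\<ge>N. dist (ell2_nth (X i) n) (ell2_nth (X j) n) < e"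
    proof (intro exI[of _ N] allI impI)
      fix i j assume "N \<le> i" "N \<le> j"
      then have "norm (X i - X j) < e" using N by (simp add: dist_norm)
      then show "dist (ell2_nth (X i) n) (ell2_nth (X j) n) < e"
        using abs_ell2_nth_le_norm[of "X i - X j" n]
        by (simp add: dist_real_def minus_ell2.rep_eq)
    qed
  qed
  then obtain l where l: "\<And>n. (\<lambda>m. ell2_nth (X m) n) \<longlonglongrightarrow> l n"
    unfolding convergent_def by metis
  have tail: "\<exists>N. \<forall>m\<ge>N. \<forall>k. (\<Sum>n<k. (ell2_nth (X m) n - l n)\<^sup>2) \<le> e\<^sup>2" if e: "0 < e" for e
  proof -
    obtain N where N: "\<And>i j. i \<ge> N \<Longrightarrow> j \<ge> N \<Longrightarrow> dist (X i) (X j) < e"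
      using metric_CauchyD[OF X e] by blast
    have "(\<Sum>n<k. (ell2_nth (X m) n - l n)\<^sup>2) \<le> e\<^sup>2" if m: "m \<ge> N" for m k
    proof (rule LIMSEQ_le_const2)
      show "(\<lambda>j. \<Sum>n<k. (ell2_nth (X m) n - ell2_nth (X j) n)\<^sup>2)
              \<longlonglongrightarrow> (\<Sum>n<k. (ell2_nth (X m) n - l n)\<^sup>2)"
        by (intro tendsto_intros l)
      show "\<exists>M. \<forall>j\<ge>M. (\<Sum>n<k. (ell2_nth (X m) n - ell2_nth (X j) n)\<^sup>2) \<le> e\<^sup>2"
      proof (intro exI[of _ N] allI impI)
        fix j assume "N \<le> j"
        then have "(norm (X m - X j))\<^sup>2 \<le> e\<^sup>2"
          using N[OF m, of j] by (intro power_mono) (auto simp: dist_norm)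
        then show "(\<Sum>n<k. (ell2_nth (X m) n - ell2_nth (X j) n)\<^sup>2) \<le> e\<^sup>2"
          using sum_squares_le_norm_ell2[of "X m - X j" k] by (simp add: minus_ell2.rep_eq)
      qed
    qed
    then show ?thesis by blast
  qed
  have "summable (\<lambda>n. (l n)\<^sup>2)"
  proof -
    obtain m where m: "\<And>k. (\<Sum>n<k. (ell2_nth (X m) n - l n)\<^sup>2) \<le> 1\<^sup>2"
      using tail[of 1] by (metis order_refl zero_less_one)
    have "summable (\<lambda>n. (ell2_nth (X m) n - l n)\<^sup>2)"
      by (rule summableI_nonneg_bounded[OF _ m]) simp
    then have "summable (\<lambda>n. (l n - ell2_nth (X m) n)\<^sup>2)"
      by (simp add: power2_commute)
    from summable_square_add[OF this summable_ell2[of "X m"]] show ?thesis by simp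
  qed
  then have L: "ell2_nth (Abs_ell2 l) = l" by (simp add: Abs_ell2_inverse)
  have "X \<longlonglongrightarrow> Abs_ell2 l"
  proof (rule metric_LIMSEQ_I)
    fix r :: real assume r: "0 < r"
    then obtain N where N: "\<And>m k. m \<ge> N \<Longrightarrow> (\<Sum>n<k. (ell2_nth (X m) n - l n)\<^sup>2) \<le> (r/2)\<^sup>2"
      using tail[of "r/2"] by auto
    have "norm (X m - Abs_ell2 l) \<le> r/2" if "m \<ge> N" for m
      using r N[OF that] by (intro norm_ell2_leI) (simp_all add: minus_ell2.rep_eq L)
    then show "\<exists>N. \<forall>m\<ge>N. dist (X m) (Abs_ell2 l) < r"
      using r by (intro exI[of _ N]) (force simp: dist_norm)
  qed
  then show "convergent X" by (rule convergentI)
qed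

section \<open>Nagata dimension\<close>

text \<open>
  The metric space \<open>M\<close> is the whole type \<open>'m\<close>.  The library's \<^const>\<open>diameter\<close> is meaningful
  for bounded sets only, so boundedness accompanies each diameter bound.
\<close>

definition finite_nagata_dimension :: "'m::metric_space itself \<Rightarrow> bool"
  where "finite_nagata_dimension _ \<longleftrightarrow>
    (\<exists>(d::nat) (\<gamma>::real). \<gamma> > 0 \<and>
      (\<forall>s>0. \<exists>\<C> :: 'm set set.
         \<Union>\<C> = UNIV \<and>
         (\<forall>B\<in>\<C>. bounded B \<and> diameter B \<le> \<gamma> * s) \<and>
         (\<forall>A. bounded A \<and> diameter A < s \<longrightarrow>
            finite {B\<in>\<C>. B \<inter> A \<noteq> {}} \<and> card {B\<in>\<C>. B \<inter> A \<noteq> {}} \<le> d + 1)))"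

section \<open>Lipschitz functions and upper gradients\<close>

definition Lip :: "('m::metric_space \<Rightarrow> 'b::metric_space) set"
  where "Lip = {f. \<exists>L. L-lipschitz_on UNIV f}"

definition lip_seminorm :: "('m::metric_space \<Rightarrow> real) \<Rightarrow> real"
  where "lip_seminorm f = Inf {L. L-lipschitz_on UNIV f}"

definition upper_gradient :: "('m::metric_space \<Rightarrow> ennreal) \<Rightarrow> ('m \<Rightarrow> real) \<Rightarrow> bool"
  where "upper_gradient g f \<longleftrightarrow>
    g \<in> borel_measurable borel \<and>
    (\<forall>p q (l::real) c. 0 \<le> l \<and> 1-lipschitz_on {0..l} c \<and> c 0 = p \<and> c l = q \<longrightarrow>
       ennreal \<bar>f q - f p\<bar> \<le> (\<integral>\<^sup>+ s\<in>{0..l}. g (c s) \<partial>lborel))"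

section \<open>ACUG structures\<close>

definition linear_subspace_of_functions :: "('m \<Rightarrow> real) set \<Rightarrow> bool"
  where "linear_subspace_of_functions H \<longleftrightarrow>
    (\<lambda>_. 0) \<in> H \<and>
    (\<forall>f\<in>H. \<forall>g\<in>H. (\<lambda>x. f x + g x) \<in> H) \<and>
    (\<forall>a. \<forall>f\<in>H. (\<lambda>x. a * f x) \<in> H)"

definition linear_operator_on :: "('m \<Rightarrow> real) set \<Rightarrow> (('m \<Rightarrow> real) \<Rightarrow> 'v::real_vector) \<Rightarrow> bool"
  where "linear_operator_on H \<Phi> \<longleftrightarrow>
    (\<forall>f\<in>H. \<forall>g\<in>H. \<Phi> (\<lambda>x. f x + g x) = \<Phi> f + \<Phi> g) \<and>
    (\<forall>a. \<forall>f\<in>H. \<Phi> (\<lambda>x. a * f x) = a *\<^sub>R \<Phi> f)"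

text \<open>
  The dual \<open>X\<^sup>*\<close> is \<^typ>\<open>'x \<Rightarrow>\<^sub>L real\<close> with the operator norm, and \<open>\<C>\<^sub>b(M, X\<^sup>*)\<close> is
  \<^typ>\<open>'m \<Rightarrow>\<^sub>C ('x \<Rightarrow>\<^sub>L real)\<close> with the supremum norm.  An operator with domain \<open>H\<close> is a total
  function of which only the values on \<open>H\<close> matter.
\<close>

definition acug_pair ::
  "real \<Rightarrow> real \<Rightarrow> ('m::metric_space \<Rightarrow> real) set
     \<Rightarrow> (('m \<Rightarrow> real) \<Rightarrow> ('m \<Rightarrow>\<^sub>C ('x::banach \<Rightarrow>\<^sub>L real))) \<Rightarrow> bool"
  where "acug_pair C \<epsilon> H \<Phi> \<longleftrightarrow>
    H \<subseteq> Lip \<and> linear_subspace_of_functions H \<and> linear_operator_on H \<Phi> \<and>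
    (\<forall>f\<in>Lip. lip_seminorm f \<le> 1 \<longrightarrow>
       (\<exists>g\<in>H. lip_seminorm g \<le> C \<and> norm (\<Phi> g) \<le> C \<and> (\<forall>x. \<bar>f x - g x\<bar> \<le> \<epsilon>))) \<and>
    (\<forall>f\<in>H. upper_gradient (\<lambda>x. ennreal (norm (apply_bcontfun (\<Phi> f) x))) f)"

definition has_acug_structure :: "'m::metric_space itself \<Rightarrow> 'x::banach itself \<Rightarrow> bool"
  where "has_acug_structure _ _ \<longleftrightarrow>
    (\<exists>C>0. \<forall>\<epsilon>>0. \<exists>H (\<Phi> :: ('m \<Rightarrow> real) \<Rightarrow> ('m \<Rightarrow>\<^sub>C ('x \<Rightarrow>\<^sub>L real))). acug_pair C \<epsilon> H \<Phi>)"

text \<open>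
  A map into \<open>\<ell>\<^sub>2\<^sup>*\<close> that is Lipschitz as a map into \<open>\<ell>\<^sub>2\<close>, under the Riesz identification
  \<open>v \<mapsto> \<langle>v, \<cdot>\<rangle>\<close>.
\<close>

definition Lip_ell2 :: "('m::metric_space \<Rightarrow>\<^sub>C (ell2 \<Rightarrow>\<^sub>L real)) set"
  where "Lip_ell2 = {\<phi>. \<exists>F :: 'm \<Rightarrow> ell2. F \<in> Lip \<and>
    (\<forall>x. apply_bcontfun \<phi> x = blinfun_inner_right (F x))}"

end

(*
  From a Nagata cover at scale r one builds a partition of unity p_i, Lipschitz with constant O(1/r) and
  of bounded multiplicity, with p_i (j) = delta_ij on a finite net. The subspace H consists of the
  interpolants f = sum_i f(i) p_i, and f is sent to the map whose i-th coordinate at x is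
  L (f(i) - f(x)) q_i(x), where L = O(1/r) and q_i is a cutoff equal to 1 near the support of p_i. Since
  f(y) - f(x) = sum_i (f(i) - f(x)) (p_i(y) - p_i(x)), Cauchy-Schwarz over the boundedly many active
  indices bounds the local Lipschitz constant of f at x by the norm of this map, and for interpolants
  of 1-Lipschitz functions |f(i) - f(x)| = O(r) cancels the factor 1/r.
*)

theory Submission
  imports Defs
begin

section \<open>Lipschitz maps\<close>

lemma LipI:
  assumes "\<And>x y. dist (f x) (f y) \<le> L * dist x y" "0 \<le> L"
  shows "f \<in> Lip"
  using assms by (auto simp: Lip_def lipschitz_on_def)

lemma continuous_on_Lip: "f \<in> Lip \<Longrightarrow> continuous_on A f"
  by (auto simp: Lip_def intro: lipschitz_on_continuous_on continuous_on_subset[of UNIV])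

lemma bounded_range_Lip:
  fixes f :: "'m::metric_space \<Rightarrow> 'b::metric_space"
  assumes "compact (UNIV :: 'm set)" "f \<in> Lip"
  shows "bounded (range f)"
  by (intro compact_imp_bounded compact_continuous_image continuous_on_Lip assms)

lemma Lip_const: "(\<lambda>_. c) \<in> Lip"
  by (rule LipI[where L = 0]) auto

lemma Lip_add:
  fixes f g :: "'m::metric_space \<Rightarrow> 'b::real_normed_vector"
  shows "f \<in> Lip \<Longrightarrow> g \<in> Lip \<Longrightarrow> (\<lambda>x. f x + g x) \<in> Lip"
  unfolding Lip_def by (auto intro: lipschitz_on_add)

lemma Lip_diff:
  fixes f g :: "'m::metric_space \<Rightarrow> 'b::real_normed_vector"
  shows "f \<in> Lip \<Longrightarrow> g \<in> Lip \<Longrightarrow> (\<lambda>x. f x - g x) \<in> Lip"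
  unfolding Lip_def by (auto intro: lipschitz_on_diff)

lemma Lip_sum:
  fixes f :: "'i \<Rightarrow> 'm::metric_space \<Rightarrow> 'b::real_normed_vector"
  assumes "\<And>i. i \<in> I \<Longrightarrow> f i \<in> Lip"
  shows "(\<lambda>x. \<Sum>i\<in>I. f i x) \<in> Lip"
  using assms by (induction I rule: infinite_finite_induct) (simp_all add: Lip_const Lip_add)

text \<open>Compactness bounds both factors, and this turns the product rule estimate into a global
  Lipschitz bound.\<close>

lemma Lip_scaleR:
  fixes f :: "'m::metric_space \<Rightarrow> real" and g :: "'m \<Rightarrow> 'b::real_normed_vector"
  assumes "compact (UNIV :: 'm set)" and fg: "f \<in> Lip" "g \<in> Lip"
  shows "(\<lambda>x. f x *\<^sub>R g x) \<in> Lip"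
proof -
  obtain K L where K: "K-lipschitz_on UNIV f" and L: "L-lipschitz_on UNIV g"
    using fg by (auto simp: Lip_def)
  obtain a b where a: "\<And>x. norm (f x) \<le> a" and b: "\<And>x. norm (g x) \<le> b"
    using bounded_range_Lip[OF assms(1) fg(1)] bounded_range_Lip[OF assms(1) fg(2)]
    unfolding bounded_iff by auto
  have a0: "0 \<le> a" and b0: "0 \<le> b"
    using norm_ge_zero a b order_trans by blast+
  show ?thesis
  proof (rule LipI[where L = "a * L + K * b"])
    fix x y
    have "f x *\<^sub>R g x - f y *\<^sub>R g y = f x *\<^sub>R (g x - g y) + (f x - f y) *\<^sub>R g y"
      by (simp add: algebra_simps)
    then have "dist (f x *\<^sub>R g x) (f y *\<^sub>R g y) \<le> norm (f x) * norm (g x - g y) + norm (f x - f y) * norm (g y)"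
      by (metis dist_norm norm_scaleR norm_triangle_ineq real_norm_def)
    also have "\<dots> \<le> a * (L * dist x y) + (K * dist x y) * b"
      using lipschitz_onD[OF K, of x y] lipschitz_onD[OF L, of x y] a b a0 lipschitz_on_nonneg[OF K]
      by (intro add_mono mult_mono) (auto simp: dist_norm)
    finally show "dist (f x *\<^sub>R g x) (f y *\<^sub>R g y) \<le> (a * L + K * b) * dist x y"
      by (simp add: algebra_simps)
  qed (use a0 b0 lipschitz_on_nonneg[OF K] lipschitz_on_nonneg[OF L] in auto)
qed

lemma lip_seminorm_le: "L-lipschitz_on UNIV f \<Longrightarrow> lip_seminorm f \<le> L"
  unfolding lip_seminorm_def
  by (rule cInf_lower) (auto intro!: bdd_belowI[where m = 0] dest: lipschitz_on_nonneg)

text \<open>The infimum defining the seminorm is attained: every admissible constant bounds the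
  difference quotient, hence so does their infimum.\<close>

lemma dist_le_lip_seminorm:
  assumes "f \<in> Lip"
  shows "\<bar>f x - f y\<bar> \<le> lip_seminorm f * dist x y"
proof (cases "x = y")
  case False
  have "\<bar>f x - f y\<bar> / dist x y \<le> lip_seminorm f"
    unfolding lip_seminorm_def
  proof (rule cInf_greatest)
    show "{L. L-lipschitz_on UNIV f} \<noteq> {}" using assms by (auto simp: Lip_def)
    fix L assume "L \<in> {L. L-lipschitz_on UNIV f}"
    then show "\<bar>f x - f y\<bar> / dist x y \<le> L"
      using False lipschitz_onD[of L UNIV f x y] by (simp add: field_simps dist_real_def)
  qed
  with False show ?thesis by (simp add: field_simps)
qed simp

section \<open>Upper gradients from uniformly local Lipschitz bounds\<close>

lemma nn_integral_split_at:
  fixes g :: "real \<Rightarrow> ennreal"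
  assumes "g \<in> borel_measurable borel" "a \<le> b" "b \<le> c"
  shows "(\<integral>\<^sup>+ s\<in>{a..<c}. g s \<partial>lborel) = (\<integral>\<^sup>+ s\<in>{a..<b}. g s \<partial>lborel) + (\<integral>\<^sup>+ s\<in>{b..<c}. g s \<partial>lborel)"
proof -
  note [measurable] = assms(1)
  have "(\<integral>\<^sup>+ s\<in>{a..<c}. g s \<partial>lborel) = (\<integral>\<^sup>+ s. g s * indicator {a..<b} s + g s * indicator {b..<c} s \<partial>lborel)"
    using assms(2,3) by (intro nn_integral_cong) (auto simp: indicator_def)
  also have "\<dots> = (\<integral>\<^sup>+ s\<in>{a..<b}. g s \<partial>lborel) + (\<integral>\<^sup>+ s\<in>{b..<c}. g s \<partial>lborel)"
    by (intro nn_integral_add) measurable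
  finally show ?thesis .
qed

text \<open>
  Inserting an intermediate point \<open>c w\<close> bounds the increment between \<open>c t\<close> and \<open>c u\<close> by
  \<open>G (c w) (u - t)\<close> for every \<open>w\<close> between \<open>t\<close> and \<open>u\<close>, hence by the integral of \<open>G \<circ> c\<close>.
\<close>

lemma upper_gradient_if_uniformly_local:
  fixes f :: "'m::metric_space \<Rightarrow> real"
  assumes r: "0 < r"
    and loc: "\<And>x y. dist x y < r \<Longrightarrow> \<bar>f y - f x\<bar> \<le> G x * dist x y"
    and cont: "continuous_on UNIV G" and nonneg: "\<And>x. 0 \<le> G x"
  shows "upper_gradient (\<lambda>x. ennreal (G x)) f"
  unfolding upper_gradient_def
proof (intro conjI allI impI)
  have "G \<in> borel_measurable borel" using cont by (rule borel_measurable_continuous_onI)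
  then show "(\<lambda>x. ennreal (G x)) \<in> borel_measurable borel" by measurable
  fix p q and l :: real and c :: "real \<Rightarrow> 'm"
  assume "0 \<le> l \<and> 1-lipschitz_on {0..l} c \<and> c 0 = p \<and> c l = q"
  then have l: "0 \<le> l" and lip: "1-lipschitz_on {0..l} c" and c0: "c 0 = p" and cl: "c l = q"
    by auto
  \<comment> \<open>Clamping the parameter to \<open>{0..l}\<close> gives a Borel integrand on the
    whole line, although \<open>c\<close> is controlled on that interval only.\<close>
  define k where "k s = ennreal (G (c (max 0 (min l s))))" for s
  have proj: "continuous_on UNIV (\<lambda>s. c (max 0 (min l s)))"
    using l by (intro continuous_on_compose2[OF lipschitz_on_continuous_on[OF lip]] continuous_intros) auto
  have "continuous_on UNIV (\<lambda>s. G (c (max 0 (min l s))))"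
    by (rule continuous_on_compose2[OF cont proj]) auto
  then have "(\<lambda>s. G (c (max 0 (min l s)))) \<in> borel_measurable borel"
    by (rule borel_measurable_continuous_onI)
  then have km: "k \<in> borel_measurable borel" unfolding k_def by measurable
  have dc: "dist (c s) (c t) \<le> \<bar>s - t\<bar>" if "s \<in> {0..l}" "t \<in> {0..l}" for s t
    using lipschitz_onD[OF lip that] by (simp add: dist_real_def)
  have step: "ennreal \<bar>f (c u) - f (c t)\<bar> \<le> (\<integral>\<^sup>+ s\<in>{t..<u}. k s \<partial>lborel)"
    if t: "0 \<le> t" "t \<le> u" "u \<le> l" "u - t < r" for t u
  proof (cases "t = u")
    case False
    have w: "\<bar>f (c u) - f (c t)\<bar> \<le> G (c w) * (u - t)" if w: "w \<in> {t..<u}" for w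
    proof -
      have d: "dist (c w) (c u) \<le> u - w" "dist (c w) (c t) \<le> w - t"
        using dc[of w u] dc[of w t] t w by auto
      have "\<bar>f (c u) - f (c w)\<bar> \<le> G (c w) * (u - w)"
        using loc[of "c w" "c u"] d w t mult_left_mono[OF d(1) nonneg[of "c w"]] by auto
      moreover have "\<bar>f (c t) - f (c w)\<bar> \<le> G (c w) * (w - t)"
        using loc[of "c w" "c t"] d w t mult_left_mono[OF d(2) nonneg[of "c w"]] by auto
      ultimately have "\<bar>f (c u) - f (c t)\<bar> \<le> G (c w) * (u - w) + G (c w) * (w - t)" by linarith
      then show ?thesis by (simp add: algebra_simps)
    qed
    \<comment> \<open>The average slope is a constant lying below the integrand on all of
      \<open>{t..<u}\<close>, by the pointwise bound just proved.\<close>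
    define \<alpha> where "\<alpha> = \<bar>f (c u) - f (c t)\<bar> / (u - t)"
    have ut: "0 < u - t" using False t by simp
    have "ennreal \<bar>f (c u) - f (c t)\<bar> = ennreal \<alpha> * emeasure lborel {t..<u}"
      using ut t by (simp add: \<alpha>_def flip: ennreal_mult)
    also have "\<dots> = (\<integral>\<^sup>+ s\<in>{t..<u}. ennreal \<alpha> \<partial>lborel)"
      by (rule nn_integral_cmult_indicator[symmetric]) simp
    also have "\<dots> \<le> (\<integral>\<^sup>+ s\<in>{t..<u}. k s \<partial>lborel)"
    proof (rule nn_integral_mono)
      fix s
      show "ennreal \<alpha> * indicator {t..<u} s \<le> k s * indicator {t..<u} s"
      proof (cases "s \<in> {t..<u}")
        case True
        then have "max 0 (min l s) = s" using t by auto
        moreover have "\<alpha> \<le> G (c s)" using w[OF True] ut by (simp add: \<alpha>_def field_simps)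
        ultimately show ?thesis using True by (simp add: k_def ennreal_leI)
      qed simp
    qed
    finally show ?thesis .
  qed simp
  \<comment> \<open>Steps of length \<open>r / 2\<close> stay below the locality radius
    \<open>r\<close>; the cap \<open>min l\<close> in the induction makes the last one end exactly
    at \<open>l\<close>.\<close>
  obtain n :: nat where n: "l < real n * (r / 2)"
    using reals_Archimedean3[of "r / 2"] r by auto
  have "ennreal \<bar>f (c (min l (real m * (r / 2)))) - f (c 0)\<bar> \<le> (\<integral>\<^sup>+ s\<in>{0..<min l (real m * (r / 2))}. k s \<partial>lborel)" for m
  proof (induction m)
    case 0
    then show ?case using l by simp
  next
    case (Suc m)
    let ?t = "min l (real m * (r / 2))" and ?u = "min l (real (Suc m) * (r / 2))"
    have t: "0 \<le> ?t" "?t \<le> ?u" "?u - ?t < r"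
      using r l by (auto simp: min_def algebra_simps)
    have "ennreal \<bar>f (c ?u) - f (c 0)\<bar> \<le> ennreal (\<bar>f (c ?t) - f (c 0)\<bar> + \<bar>f (c ?u) - f (c ?t)\<bar>)"
      by (rule ennreal_leI) linarith
    also have "\<dots> = ennreal \<bar>f (c ?t) - f (c 0)\<bar> + ennreal \<bar>f (c ?u) - f (c ?t)\<bar>" by simp
    also have "\<dots> \<le> (\<integral>\<^sup>+ s\<in>{0..<?t}. k s \<partial>lborel) + (\<integral>\<^sup>+ s\<in>{?t..<?u}. k s \<partial>lborel)"
      by (intro add_mono Suc.IH step t) simp
    also have "\<dots> = (\<integral>\<^sup>+ s\<in>{0..<?u}. k s \<partial>lborel)"
      by (rule nn_integral_split_at[OF km t(1,2), symmetric])
    finally show ?case .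
  qed
  from this[of n] n have "ennreal \<bar>f q - f p\<bar> \<le> (\<integral>\<^sup>+ s\<in>{0..<l}. k s \<partial>lborel)"
    by (simp add: min_absorb1 c0 cl)
  also have "\<dots> \<le> (\<integral>\<^sup>+ s\<in>{0..l}. ennreal (G (c s)) \<partial>lborel)"
    by (rule nn_integral_mono) (auto simp: indicator_def k_def)
  finally show "ennreal \<bar>f q - f p\<bar> \<le> (\<integral>\<^sup>+ s\<in>{0..l}. ennreal (G (c s)) \<partial>lborel)" .
qed

section \<open>Orthonormal families and the Riesz identification\<close>

text \<open>An injection of the index set into the naturals transports the standard unit vectors.
  The indices will be the points of a finite net, one coordinate for each.\<close>

lemma exists_orthonormal_ell2:
  assumes "finite I"
  obtains u :: "'i \<Rightarrow> ell2" where "\<And>i j. i \<in> I \<Longrightarrow> j \<in> I \<Longrightarrow> inner (u i) (u j) = (if i = j then 1 else 0)"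
proof -
  obtain h :: "'i \<Rightarrow> nat" where h: "inj_on h I"
    using assms finite_imp_inj_to_nat_seg by metis
  define b where "b n = Abs_ell2 (\<lambda>m. if m = n then 1 else 0)" for n :: nat
  have "summable (\<lambda>m. (if m = n then 1 else 0 :: real)\<^sup>2)" for n :: nat
    by (rule summable_finite[of "{n}"]) auto
  then have nth: "ell2_nth (b n) = (\<lambda>m. if m = n then 1 else 0)" for n
    by (simp add: b_def Abs_ell2_inverse)
  have "inner (b m) (b n) = (if m = n then 1 else 0)" for m n
    unfolding inner_ell2_def nth
    by (subst suminf_finite[of "{m}"]) auto
  then show ?thesis
    using h by (intro that[of "b \<circ> h"]) (auto simp: inj_on_def)
qed

lemma norm_orthonormal_sum:
  fixes u :: "'i \<Rightarrow> 'a::real_inner"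
  assumes "finite I" "\<And>i j. i \<in> I \<Longrightarrow> j \<in> I \<Longrightarrow> inner (u i) (u j) = (if i = j then 1 else 0)"
  shows "(norm (\<Sum>i\<in>I. a i *\<^sub>R u i))\<^sup>2 = (\<Sum>i\<in>I. (a i)\<^sup>2)"
proof -
  have "(norm (\<Sum>i\<in>I. a i *\<^sub>R u i))\<^sup>2 = (\<Sum>i\<in>I. \<Sum>j\<in>I. a i * (a j * inner (u i) (u j)))"
    by (simp add: power2_norm_eq_inner inner_sum_left inner_sum_right sum_distrib_left)
       (intro sum.cong refl; simp add: inner_commute mult_ac)
  also have "\<dots> = (\<Sum>i\<in>I. \<Sum>j\<in>I. if i = j then a i * a j else 0)"
    by (intro sum.cong) (auto simp: assms(2))
  also have "\<dots> = (\<Sum>i\<in>I. (a i)\<^sup>2)"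
    using assms(1) by (simp add: power2_eq_square)
  finally show ?thesis .
qed

text \<open>Cauchy-Schwarz gives one inequality, and testing the functional on \<open>v\<close>
  itself gives the other.\<close>

lemma norm_blinfun_inner_right: "norm (blinfun_inner_right v) = norm (v :: 'a::real_inner)"
proof (rule antisym)
  show "norm (blinfun_inner_right v) \<le> norm v"
    by (rule norm_blinfun_bound) (auto intro: Cauchy_Schwarz_ineq2)
  have "norm v * norm v \<le> norm (blinfun_inner_right v) * norm v"
    using norm_blinfun[of "blinfun_inner_right v" v] by (simp add: power2_eq_square flip: power2_norm_eq_inner)
  then show "norm v \<le> norm (blinfun_inner_right v)"
    by (cases "v = 0") auto
qed

section \<open>Nets with bounded multiplicity\<close>

text \<open>The product of the Lipschitz constant \<open>(2 * N + 1) / r\<close> of the partition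
  functions, the multiplicity \<open>N\<close> and the oscillation bound
  \<open>2 * (\<kappa> + 3) * r\<close>. The scale \<open>r\<close> cancels, so one constant serves
  all scales.\<close>

definition net_const :: "real \<Rightarrow> nat \<Rightarrow> real"
  where "net_const \<kappa> N = 2 * real N * (2 * real N + 1) * (\<kappa> + 3)"

text \<open>
  The sets \<open>D i\<close> are not the members of a Nagata cover: \<open>separated\<close> makes the partition of unity
  subordinate to them take the value \<open>1\<close> at its own net point, so the coefficients of an
  interpolant are its values on \<open>X\<close> and the operator below is well defined.
\<close>

locale nagata_net =
  fixes X :: "'m::metric_space set" and D :: "'m \<Rightarrow> 'm set" and r \<kappa> :: real and N :: nat
  assumes compact_space: "compact (UNIV :: 'm set)"
    and finite_X: "finite X" and r_pos: "0 < r"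
    and covers: "\<exists>i\<in>X. x \<in> D i"
    and center: "i \<in> X \<Longrightarrow> i \<in> D i"
    and diam: "i \<in> X \<Longrightarrow> x \<in> D i \<Longrightarrow> dist x i \<le> \<kappa> * r"
    and mult: "card {i\<in>X. infdist x (D i) < 3 * r} \<le> N"
    and separated: "i \<in> X \<Longrightarrow> j \<in> X \<Longrightarrow> i \<noteq> j \<Longrightarrow> r \<le> infdist i (D j)"
begin

definition bump :: "'m \<Rightarrow> 'm \<Rightarrow> real"
  where "bump i x = max 0 (1 - infdist x (D i) / r)"

definition total :: "'m \<Rightarrow> real"
  where "total x = (\<Sum>i\<in>X. bump i x)"

definition part :: "'m \<Rightarrow> 'm \<Rightarrow> real"
  where "part i x = bump i x / total x"

text \<open>A plateau of height 1 up to distance \<open>2 * r\<close> from \<open>D i\<close>,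
  falling to 0 at \<open>3 * r\<close>. It covers every index whose bump is nonzero at
  \<open>x\<close> or at a point within \<open>r\<close> of \<open>x\<close>.\<close>

definition cutoff :: "'m \<Rightarrow> 'm \<Rightarrow> real"
  where "cutoff i x = max 0 (min 1 (3 - infdist x (D i) / r))"

definition interp :: "('m \<Rightarrow> real) \<Rightarrow> 'm \<Rightarrow> real"
  where "interp f x = (\<Sum>i\<in>X. f i * part i x)"

text \<open>Since \<open>interp\<close> is a linear projection, its fixed points form a linear
  subspace, which is also its range.\<close>

definition H :: "('m \<Rightarrow> real) set"
  where "H = {f. interp f = f}"

definition Lp :: real
  where "Lp = (2 * real N + 1) / r"

section \<open>The Lipschitz partition of unity\<close>

lemma infdist_div_diff: "\<bar>infdist x (D i) / r - infdist y (D i) / r\<bar> \<le> dist x y / r"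
  using infdist_triangle_abs[of x "D i" y] r_pos
  by (simp add: divide_right_mono flip: diff_divide_distrib)

lemma bump_diff: "\<bar>bump i x - bump i y\<bar> \<le> dist x y / r"
  using infdist_div_diff[of x i y] unfolding bump_def by linarith

lemma cutoff_diff: "\<bar>cutoff i x - cutoff i y\<bar> \<le> dist x y / r"
  using infdist_div_diff[of x i y] unfolding cutoff_def by linarith

lemma cutoff_eq_1: "infdist x (D i) < 2 * r \<Longrightarrow> cutoff i x = 1"
  using r_pos by (simp add: cutoff_def field_simps)

lemma cutoff_eq_0: "\<not> infdist x (D i) < 3 * r \<Longrightarrow> cutoff i x = 0"
  using r_pos by (simp add: cutoff_def field_simps)

lemma cutoff_range: "0 \<le> cutoff i x" "cutoff i x \<le> 1"
  by (auto simp: cutoff_def)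

lemma bump_nonneg: "0 \<le> bump i x"
  by (simp add: bump_def)

lemma bump_eq_0: "\<not> infdist x (D i) < r \<Longrightarrow> bump i x = 0"
  using r_pos by (simp add: bump_def field_simps)

lemma total_ge_1: "1 \<le> total x"
proof -
  obtain i where i: "i \<in> X" "x \<in> D i" using covers by blast
  then have "bump i x = 1" by (simp add: bump_def)
  then show ?thesis
    using member_le_sum[OF i(1), of "\<lambda>i. bump i x"] finite_X by (simp add: total_def bump_nonneg)
qed

text \<open>Only indices near \<open>x\<close> or near \<open>y\<close> contribute, at most
  \<open>N\<close> for each point, so the bound does not grow with the size of
  \<open>X\<close>.\<close>

lemma total_diff: "\<bar>total x - total y\<bar> \<le> 2 * real N * (dist x y / r)"
proof -
  define A where "A z = {i\<in>X. infdist z (D i) < 3 * r}" for z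
  have fin: "finite (A z)" for z using finite_X by (simp add: A_def)
  have out: "bump i z = 0" if "i \<in> X" "i \<notin> A z" for i z
    using that r_pos by (intro bump_eq_0) (auto simp: A_def)
  have "total x - total y = (\<Sum>i\<in>X. bump i x - bump i y)"
    by (simp add: total_def sum_subtractf)
  also have "\<dots> = (\<Sum>i\<in>A x \<union> A y. bump i x - bump i y)"
    by (rule sum.mono_neutral_right) (use finite_X out in \<open>auto simp: A_def\<close>)
  also have "\<bar>\<dots>\<bar> \<le> (\<Sum>i\<in>A x \<union> A y. dist x y / r)"
    by (intro order_trans[OF sum_abs] sum_mono bump_diff)
  also have "\<dots> = real (card (A x \<union> A y)) * (dist x y / r)" by simp
  also have "\<dots> \<le> (2 * real N) * (dist x y / r)"
  proof (rule mult_right_mono)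
    have "card (A x \<union> A y) \<le> N + N"
      by (rule order_trans[OF card_Un_le add_mono]) (use mult in \<open>auto simp: A_def\<close>)
    then show "real (card (A x \<union> A y)) \<le> 2 * real N" by linarith
  qed (use r_pos in simp)
  finally show ?thesis .
qed

lemma part_nonneg: "0 \<le> part i x"
  using total_ge_1[of x] by (simp add: part_def bump_nonneg)

lemma part_eq_0: "\<not> infdist x (D i) < r \<Longrightarrow> part i x = 0"
  by (simp add: part_def bump_eq_0)

lemma sum_part: "(\<Sum>i\<in>X. part i x) = 1"
  using total_ge_1[of x] by (simp add: part_def total_def flip: sum_divide_distrib)

lemma part_diff:
  assumes "i \<in> X"
  shows "\<bar>part i x - part i y\<bar> \<le> Lp * dist x y"
proof -
  have T: "1 \<le> total x" "1 \<le> total y" by (rule total_ge_1)+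
  have le1: "part i y \<le> 1"
    using member_le_sum[OF assms, of "\<lambda>i. part i y"] finite_X by (simp add: part_nonneg sum_part)
  \<comment> \<open>Dividing by \<open>total x\<close>, which is at least 1, only shrinks the
    numerator. Its two summands contribute \<open>1 / r\<close> and \<open>2 * N / r\<close>, which
    add up to \<open>Lp\<close>.\<close>
  have "part i x - part i y = ((bump i x - bump i y) + part i y * (total y - total x)) / total x"
    using T by (simp add: part_def field_simps)
  also have "\<bar>\<dots>\<bar> \<le> \<bar>(bump i x - bump i y) + part i y * (total y - total x)\<bar>"
    using T by (simp add: abs_divide divide_le_eq mult_le_cancel_left1)
  also have "\<dots> \<le> \<bar>bump i x - bump i y\<bar> + \<bar>part i y\<bar> * \<bar>total y - total x\<bar>"
    by (metis abs_triangle_ineq abs_mult)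
  also have "\<dots> \<le> dist x y / r + 1 * (2 * real N * (dist x y / r))"
    using total_diff[of y x] le1 part_nonneg[of i y]
    by (intro add_mono mult_mono bump_diff) (auto simp: dist_commute)
  also have "\<dots> = Lp * dist x y"
    using r_pos by (simp add: Lp_def field_simps)
  finally show ?thesis .
qed

text \<open>Separation makes all other partition functions vanish at a net point, and the sum being
  1 then forces the remaining value.\<close>

lemma part_net:
  assumes "i \<in> X" "j \<in> X"
  shows "part i j = (if i = j then 1 else 0)"
proof -
  have off: "part k j = 0" if "k \<in> X" "k \<noteq> j" for k
    using separated[OF assms(2) that(1)] that(2) by (intro part_eq_0) auto
  have "1 = part j j + (\<Sum>k\<in>X - {j}. part k j)"
    using sum_part[of j] sum.remove[OF finite_X assms(2), of "\<lambda>k. part k j"] by simp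
  also have "(\<Sum>k\<in>X - {j}. part k j) = 0" using off by (intro sum.neutral) auto
  finally show ?thesis using off[OF assms(1)] by auto
qed

section \<open>Interpolation from the net\<close>

lemma interp_net: "j \<in> X \<Longrightarrow> interp f j = f j"
  unfolding interp_def using finite_X
  by (simp add: part_net if_distrib[of "\<lambda>t. _ * t"] cong: sum.cong if_cong)

text \<open>An interpolant depends only on the values on \<open>X\<close>, and interpolation
  reproduces those, so \<open>interp\<close> is idempotent.\<close>

lemma interp_in_H: "interp f \<in> H"
proof -
  have "interp (interp f) x = interp f x" for x
    unfolding interp_def[of "interp f"] interp_def[of f x] by (simp add: interp_net cong: sum.cong)
  then show ?thesis by (auto simp: H_def)
qed

lemma Lp_nonneg: "0 \<le> Lp"
  using r_pos by (simp add: Lp_def)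

lemma cutoff_Lip: "cutoff i \<in> Lip"
  by (rule LipI[where L = "1 / r"]) (use cutoff_diff r_pos in \<open>auto simp: dist_real_def\<close>)

lemma part_Lip: "i \<in> X \<Longrightarrow> part i \<in> Lip"
  by (rule LipI[where L = Lp]) (use part_diff Lp_nonneg in \<open>auto simp: dist_real_def\<close>)

lemma Lip_mult: "f \<in> Lip \<Longrightarrow> g \<in> Lip \<Longrightarrow> (\<lambda>x. f x * g x) \<in> Lip"
  for f g :: "'m \<Rightarrow> real"
  using Lip_scaleR[OF compact_space, of f g] by simp

lemma interp_Lip: "interp f \<in> Lip"
  unfolding interp_def by (intro Lip_sum Lip_mult Lip_const part_Lip)

lemma H_Lip: "f \<in> H \<Longrightarrow> f \<in> Lip"
  using interp_Lip[of f] by (simp add: H_def)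

lemma subspace_H: "linear_subspace_of_functions H"
  unfolding linear_subspace_of_functions_def H_def interp_def fun_eq_iff
  by (auto simp: sum.distrib distrib_right mult.assoc sum_distrib_left[symmetric])

lemma dist_center:
  assumes "i \<in> X" "infdist x (D i) < 3 * r"
  shows "dist x i \<le> (\<kappa> + 3) * r"
proof -
  have ne: "D i \<noteq> {}" using center[OF assms(1)] by auto
  then have "(INF a\<in>D i. dist x a) < 3 * r" using assms(2) by (simp add: infdist_notempty)
  then obtain z where z: "z \<in> D i" "dist x z < 3 * r"
    using cInf_lessD[of "dist x ` D i"] ne by auto
  have "dist x i \<le> dist x z + dist z i" by (rule dist_triangle)
  also have "\<dots> \<le> 3 * r + \<kappa> * r" using z diam[OF assms(1) z(1)] by linarith
  finally show ?thesis by (simp add: algebra_simps)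
qed

lemma kappa_nonneg: "0 \<le> \<kappa>"
proof -
  \<comment> \<open>Here \<open>undefined\<close> serves as some point of the space, types being
    inhabited.\<close>
  obtain i where i: "i \<in> X" "undefined \<in> D i" using covers by blast
  have "0 \<le> \<kappa> * r" using diam[OF i(1) center[OF i(1)]] by simp
  then show ?thesis using r_pos by (simp add: zero_le_mult_iff)
qed

lemma N_pos: "1 \<le> N"
proof -
  obtain i where i: "i \<in> X" "undefined \<in> D i" using covers by blast
  then have "i \<in> {i\<in>X. infdist undefined (D i) < 3 * r}" using r_pos by simp
  then have "0 < card {i\<in>X. infdist undefined (D i) < 3 * r}"
    using finite_X by (auto simp: card_gt_0_iff)
  then show ?thesis using mult[of undefined] by linarith
qed

text \<open>The interpolant at \<open>x\<close> is a convex combination of values of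
  \<open>f\<close> at net points within \<open>(\<kappa> + 3) * r\<close> of
  \<open>x\<close>.\<close>

lemma interp_approx:
  assumes f: "\<And>x y. \<bar>f x - f y\<bar> \<le> dist x y"
  shows "\<bar>f x - interp f x\<bar> \<le> (\<kappa> + 3) * r"
proof -
  have "f x - interp f x = (\<Sum>i\<in>X. (f x - f i) * part i x)"
    by (simp add: left_diff_distrib sum_subtractf sum_part interp_def flip: sum_distrib_left)
  also have "\<bar>\<dots>\<bar> \<le> (\<Sum>i\<in>X. (\<kappa> + 3) * r * part i x)"
  proof (rule order_trans[OF sum_abs sum_mono])
    fix i assume i: "i \<in> X"
    show "\<bar>(f x - f i) * part i x\<bar> \<le> (\<kappa> + 3) * r * part i x"
    proof (cases "infdist x (D i) < r")
      case True
      then have "dist x i \<le> (\<kappa> + 3) * r" using r_pos by (intro dist_center[OF i]) auto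
      then have "\<bar>f x - f i\<bar> \<le> (\<kappa> + 3) * r" using f[of x i] by linarith
      then show ?thesis using part_nonneg[of i x] by (simp add: abs_mult mult_right_mono)
    qed (simp add: part_eq_0)
  qed
  also have "\<dots> = (\<kappa> + 3) * r" by (simp add: sum_part flip: sum_distrib_left)
  finally show ?thesis .
qed

text \<open>The factor \<open>Lp\<close> is the Lipschitz constant of the partition functions, and
  \<open>sqrt N\<close> pays for Cauchy-Schwarz over at most \<open>N\<close> indices. The
  differences \<open>f i - f x\<close> keep the expression linear in \<open>f\<close>; the cutoff
  localizes it and stays Lipschitz in \<open>x\<close>.\<close>

definition grad :: "('m \<Rightarrow> ell2) \<Rightarrow> ('m \<Rightarrow> real) \<Rightarrow> 'm \<Rightarrow> ell2"
  where "grad u f x = (\<Sum>i\<in>X. (Lp * sqrt N * ((f i - f x) * cutoff i x)) *\<^sub>R u i)"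

lemma grad_Lip: "f \<in> Lip \<Longrightarrow> grad u f \<in> Lip"
  unfolding grad_def
  by (intro Lip_sum Lip_scaleR[OF compact_space] Lip_mult Lip_const Lip_diff cutoff_Lip)

lemma grad_add: "grad u (\<lambda>x. f x + g x) x = grad u f x + grad u g x"
  unfolding grad_def sum.distrib[symmetric] scaleR_left_distrib[symmetric]
  by (simp add: algebra_simps)

lemma grad_scale: "grad u (\<lambda>x. a * f x) x = a *\<^sub>R grad u f x"
  unfolding grad_def scaleR_sum_right by (simp add: algebra_simps)

abbreviation const :: real
  where "const \<equiv> net_const \<kappa> N"

section \<open>Norm estimates for the gradient map\<close>

context
  fixes u :: "'m \<Rightarrow> ell2"
  assumes u: "\<And>i j. i \<in> X \<Longrightarrow> j \<in> X \<Longrightarrow> inner (u i) (u j) = (if i = j then 1 else 0)"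
begin

lemma norm_grad: "norm (grad u f x) = Lp * sqrt N * sqrt (\<Sum>i\<in>X. ((f i - f x) * cutoff i x)\<^sup>2)"
proof -
  have "(norm (grad u f x))\<^sup>2 = (Lp * sqrt N * sqrt (\<Sum>i\<in>X. ((f i - f x) * cutoff i x)\<^sup>2))\<^sup>2"
    unfolding grad_def
    by (subst norm_orthonormal_sum[OF finite_X])
       (simp_all add: u power_mult_distrib sum_nonneg flip: sum_distrib_left)
  then show ?thesis
    using Lp_nonneg by (subst (asm) power2_eq_iff_nonneg) (auto intro!: mult_nonneg_nonneg sum_nonneg)
qed

lemma grad_local_bound:
  assumes f: "f \<in> H" and d: "dist x y < r"
  shows "\<bar>f y - f x\<bar> \<le> norm (grad u f x) * dist x y"
proof -
  define A where "A = {i\<in>X. infdist x (D i) < 2 * r}"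
  have fin: "finite A" using finite_X by (simp add: A_def)
  have "A \<subseteq> {i\<in>X. infdist x (D i) < 3 * r}" using r_pos by (auto simp: A_def)
  then have cardA: "card A \<le> N"
    using mult[of x] card_mono[of "{i\<in>X. infdist x (D i) < 3 * r}" A] finite_X by simp
  have fi: "f z = (\<Sum>i\<in>X. f i * part i z)" for z
    using f by (simp add: H_def interp_def fun_eq_iff)
  \<comment> \<open>The partition sums to 1 at both points, so \<open>f x\<close> may be subtracted
    from every coefficient.\<close>
  have "f y - f x = f y - f x * (\<Sum>i\<in>X. part i y) - (f x - f x * (\<Sum>i\<in>X. part i x))"
    by (simp add: sum_part)
  also have "\<dots> = (\<Sum>i\<in>X. (f i - f x) * (part i y - part i x))"
    by (subst (1 3) fi) (simp add: sum_distrib_left algebra_simps sum_subtractf sum.distrib)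
  also have "\<dots> = (\<Sum>i\<in>A. (f i - f x) * (part i y - part i x))"
  proof (rule sum.mono_neutral_right)
    show "\<forall>i\<in>X - A. (f i - f x) * (part i y - part i x) = 0"
    proof
      \<comment> \<open>A set at distance at least \<open>2 * r\<close> from \<open>x\<close> is at
        distance at least \<open>r\<close> from \<open>y\<close>, so its partition function vanishes
        at both points.\<close>
      fix i assume i: "i \<in> X - A"
      then have "\<not> infdist x (D i) < r" "\<not> infdist y (D i) < r"
        using infdist_triangle[of x "D i" y] d r_pos by (auto simp: A_def)
      then show "(f i - f x) * (part i y - part i x) = 0" by (simp add: part_eq_0)
    qed
  qed (use finite_X in \<open>auto simp: A_def\<close>)
  also have "\<bar>\<dots>\<bar> \<le> (\<Sum>i\<in>A. \<bar>f i - f x\<bar> * (Lp * dist x y))"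
    by (rule order_trans[OF sum_abs sum_mono])
       (auto simp: abs_mult A_def dist_commute[of x] intro!: mult_left_mono part_diff)
  also have "\<dots> = (\<Sum>i\<in>A. \<bar>f i - f x\<bar>) * (Lp * dist x y)" by (simp add: sum_distrib_right)
  also have "\<dots> \<le> (sqrt N * sqrt (\<Sum>i\<in>X. ((f i - f x) * cutoff i x)\<^sup>2)) * (Lp * dist x y)"
  proof (rule mult_right_mono)
    \<comment> \<open>Cauchy-Schwarz against the constant 1. The cutoff equals 1 on
      \<open>A\<close>, so it can be inserted before the sum is enlarged to
      \<open>X\<close>.\<close>
    have "(\<Sum>i\<in>A. \<bar>f i - f x\<bar>)\<^sup>2 \<le> (\<Sum>i\<in>A. \<bar>f i - f x\<bar>\<^sup>2) * card A"
      by (rule sum_squared_le_sum_of_squares)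
    also have "\<dots> \<le> (\<Sum>i\<in>A. \<bar>f i - f x\<bar>\<^sup>2) * N"
      using cardA by (intro mult_left_mono) (auto intro: sum_nonneg)
    also have "(\<Sum>i\<in>A. \<bar>f i - f x\<bar>\<^sup>2) = (\<Sum>i\<in>A. ((f i - f x) * cutoff i x)\<^sup>2)"
      by (intro sum.cong) (auto simp: A_def cutoff_eq_1)
    also have "\<dots> \<le> (\<Sum>i\<in>X. ((f i - f x) * cutoff i x)\<^sup>2)"
      by (rule sum_mono2) (use finite_X in \<open>auto simp: A_def\<close>)
    finally have "(\<Sum>i\<in>A. \<bar>f i - f x\<bar>)\<^sup>2 \<le> N * (\<Sum>i\<in>X. ((f i - f x) * cutoff i x)\<^sup>2)"
      by (simp add: mult_right_mono mult.commute)
    then show "(\<Sum>i\<in>A. \<bar>f i - f x\<bar>) \<le> sqrt N * sqrt (\<Sum>i\<in>X. ((f i - f x) * cutoff i x)\<^sup>2)"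
      unfolding real_sqrt_mult[symmetric] by (rule real_le_rsqrt)
  qed (use Lp_nonneg in simp)
  also have "\<dots> = norm (grad u f x) * dist x y" by (simp add: norm_grad mult_ac)
  finally show ?thesis .
qed

lemma norm_grad_interp:
  assumes f: "\<And>x y. \<bar>f x - f y\<bar> \<le> dist x y"
  shows "norm (grad u (interp f) x) \<le> const"
proof -
  define B where "B = {i\<in>X. infdist x (D i) < 3 * r}"
  \<comment> \<open>One \<open>(\<kappa> + 3) * r\<close> bounds the change of \<open>f\<close> from
    \<open>x\<close> to \<open>i\<close>, the other the interpolation error at \<open>x\<close>; at
    the net point \<open>i\<close> there is no error.\<close>
  define M where "M = 2 * (\<kappa> + 3) * r"
  have M: "0 \<le> M" using kappa_nonneg r_pos by (simp add: M_def)
  have "(\<Sum>i\<in>X. ((interp f i - interp f x) * cutoff i x)\<^sup>2)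
      = (\<Sum>i\<in>B. ((interp f i - interp f x) * cutoff i x)\<^sup>2)"
    by (rule sum.mono_neutral_right) (use finite_X in \<open>auto simp: B_def cutoff_eq_0\<close>)
  also have "\<dots> \<le> (\<Sum>i\<in>B. M\<^sup>2)"
  proof (rule sum_mono)
    fix i assume "i \<in> B"
    then have i: "i \<in> X" and "infdist x (D i) < 3 * r" by (auto simp: B_def)
    then have "dist x i \<le> (\<kappa> + 3) * r" by (intro dist_center)
    then have "\<bar>interp f i - interp f x\<bar> \<le> M"
      using interp_net[OF i, of f] f[of x i] interp_approx[OF f, of x] unfolding M_def by linarith
    then have "\<bar>(interp f i - interp f x) * cutoff i x\<bar> \<le> M * 1"
      unfolding abs_mult using cutoff_range[of i x] M by (intro mult_mono) auto
    then show "((interp f i - interp f x) * cutoff i x)\<^sup>2 \<le> M\<^sup>2"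
      using M by (simp add: abs_le_square_iff[symmetric])
  qed
  also have "\<dots> \<le> N * M\<^sup>2" using mult[of x] by (simp add: B_def mult_right_mono)
  finally have "sqrt (\<Sum>i\<in>X. ((interp f i - interp f x) * cutoff i x)\<^sup>2) \<le> sqrt (N * M\<^sup>2)"
    by (rule real_sqrt_le_mono)
  also have "\<dots> = sqrt N * M" using M by (simp add: real_sqrt_mult)
  finally have "norm (grad u (interp f) x) \<le> Lp * sqrt N * (sqrt N * M)"
    unfolding norm_grad using Lp_nonneg by (intro mult_left_mono) auto
  also have "\<dots> = Lp * real N * M" by (simp add: mult.assoc[symmetric])
  also have "\<dots> = const"
    using r_pos by (simp add: net_const_def Lp_def M_def field_simps)
  finally show ?thesis .
qed

text \<open>Below distance \<open>r\<close> the local gradient bound applies. From \<open>r\<close>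
  on, the interpolation errors at both ends are themselves multiples of
  \<open>dist x y\<close>.\<close>

lemma interp_lipschitz:
  assumes f: "\<And>x y. \<bar>f x - f y\<bar> \<le> dist x y"
  shows "const-lipschitz_on UNIV (interp f)"
proof (rule lipschitz_onI)
  \<comment> \<open>The left side is the constant of the far regime; \<open>N \<ge> 1\<close> makes
    \<open>N * (2 * N + 1)\<close> at least 3, which suffices.\<close>
  have c: "1 + 2 * (\<kappa> + 3) \<le> const"
  proof -
    have N3: "1 * 3 \<le> real N * (2 * real N + 1)"
      using N_pos by (intro mult_mono) auto
    have "1 + 2 * (\<kappa> + 3) \<le> 1 * 3 * (2 * (\<kappa> + 3))" using kappa_nonneg by simp
    also have "\<dots> \<le> real N * (2 * real N + 1) * (2 * (\<kappa> + 3))"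
      using kappa_nonneg by (intro mult_right_mono N3) auto
    also have "\<dots> = const" by (simp add: net_const_def algebra_simps)
    finally show ?thesis .
  qed
  show "0 \<le> const" by (rule order_trans[OF _ c]) (use kappa_nonneg in simp)
  fix x y
  show "dist (interp f x) (interp f y) \<le> const * dist x y"
  proof (cases "dist x y < r")
    case True
    have "dist (interp f x) (interp f y) = \<bar>interp f y - interp f x\<bar>" by (simp add: dist_real_def)
    also have "\<dots> \<le> norm (grad u (interp f) x) * dist x y"
      by (rule grad_local_bound[OF interp_in_H True])
    also have "\<dots> \<le> const * dist x y"
      by (rule mult_right_mono[OF norm_grad_interp[OF f]]) simp
    finally show ?thesis .
  next
    case False
    then have "(\<kappa> + 3) * r \<le> (\<kappa> + 3) * dist x y" using kappa_nonneg by (intro mult_left_mono) auto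
    then have "dist (interp f x) (interp f y) \<le> dist x y + 2 * ((\<kappa> + 3) * dist x y)"
      using interp_approx[OF f, of x] interp_approx[OF f, of y] f[of x y] unfolding dist_real_def by linarith
    also have "\<dots> = (1 + 2 * (\<kappa> + 3)) * dist x y" by (simp add: algebra_simps)
    also have "\<dots> \<le> const * dist x y" using c by (rule mult_right_mono) simp
    finally show ?thesis .
  qed
qed

end

text \<open>The scale \<open>r\<close> enters only through the approximation error, while
  \<open>const\<close> is independent of it.\<close>

lemma exists_acug_pair:
  assumes eps: "(\<kappa> + 3) * r \<le> \<epsilon>"
  shows "\<exists>H (\<Phi> :: ('m \<Rightarrow> real) \<Rightarrow> ('m \<Rightarrow>\<^sub>C (ell2 \<Rightarrow>\<^sub>L real))). acug_pair const \<epsilon> H \<Phi> \<and> \<Phi> ` H \<subseteq> Lip_ell2"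
proof -
  obtain u :: "'m \<Rightarrow> ell2"
    where u: "\<And>i j. i \<in> X \<Longrightarrow> j \<in> X \<Longrightarrow> inner (u i) (u j) = (if i = j then 1 else 0)"
    using exists_orthonormal_ell2[OF finite_X] by blast
  define \<Phi> :: "('m \<Rightarrow> real) \<Rightarrow> ('m \<Rightarrow>\<^sub>C (ell2 \<Rightarrow>\<^sub>L real))"
    where "\<Phi> f = Bcontfun (\<lambda>x. blinfun_inner_right (grad u f x))" for f
  have contg: "continuous_on UNIV (grad u f)" if "f \<in> H" for f
    by (intro continuous_on_Lip grad_Lip H_Lip that)
  have app: "apply_bcontfun (\<Phi> f) x = blinfun_inner_right (grad u f x)" if "f \<in> H" for f x
  proof -
    \<comment> \<open>Continuity and compactness give membership in \<open>bcontfun\<close>, without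
      which the value of \<open>Bcontfun\<close> would be unspecified.\<close>
    have c: "continuous_on UNIV (\<lambda>x. blinfun_inner_right (grad u f x))"
      by (rule bounded_linear.continuous_on[OF bounded_linear_blinfun_inner_right contg[OF that]])
    then have "(\<lambda>x. blinfun_inner_right (grad u f x)) \<in> bcontfun"
      using compact_imp_bounded[OF compact_continuous_image[OF c compact_space]] by (simp add: bcontfun_def)
    then show ?thesis by (simp add: \<Phi>_def Bcontfun_inverse)
  qed
  have sub: "(\<lambda>x. f x + g x) \<in> H" "(\<lambda>x. a * f x) \<in> H" if "f \<in> H" "g \<in> H" for f g a
    using subspace_H that by (auto simp: linear_subspace_of_functions_def)
  have "linear_operator_on H \<Phi>"
    unfolding linear_operator_on_def
    by (auto intro!: bcontfun_eqI simp: app sub grad_add grad_scale plus_bcontfun.rep_eq scaleR_bcontfun.rep_eq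
        linear_add[OF bounded_linear.linear[OF bounded_linear_blinfun_inner_right]]
        linear_scale[OF bounded_linear.linear[OF bounded_linear_blinfun_inner_right]])
  moreover have "\<exists>g\<in>H. lip_seminorm g \<le> const \<and> norm (\<Phi> g) \<le> const \<and> (\<forall>x. \<bar>f x - g x\<bar> \<le> \<epsilon>)"
    if f: "f \<in> Lip" "lip_seminorm f \<le> 1" for f
  proof (intro bexI conjI allI)
    have f1: "\<bar>f x - f y\<bar> \<le> dist x y" for x y
      using dist_le_lip_seminorm[OF f(1), of x y] mult_right_mono[OF f(2), of "dist x y"] by simp
    show "interp f \<in> H" by (rule interp_in_H)
    show "lip_seminorm (interp f) \<le> const" by (rule lip_seminorm_le[OF interp_lipschitz[OF u f1]])
    show "norm (\<Phi> (interp f)) \<le> const"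
      by (rule norm_bound) (simp add: app interp_in_H norm_blinfun_inner_right norm_grad_interp[OF u f1])
    show "\<bar>f x - interp f x\<bar> \<le> \<epsilon>" for x using interp_approx[OF f1] eps by (rule order_trans)
  qed
  moreover have "upper_gradient (\<lambda>x. ennreal (norm (apply_bcontfun (\<Phi> f) x))) f" if f: "f \<in> H" for f
    unfolding app[OF f] norm_blinfun_inner_right
    by (rule upper_gradient_if_uniformly_local[OF r_pos grad_local_bound[OF u f]])
       (auto intro: continuous_on_norm contg f)
  moreover have "\<Phi> ` H \<subseteq> Lip_ell2"
    unfolding Lip_ell2_def using app grad_Lip H_Lip by blast
  ultimately show ?thesis
    using subspace_H H_Lip unfolding acug_pair_def by blast
qed

end

section \<open>Nets obtained from Nagata covers\<close>

lemma finite_separated_net: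
  assumes "compact (UNIV :: 'm::metric_space set)" "0 < s"
  obtains X :: "'m::metric_space set" where "finite X" "\<And>x y. x \<in> X \<Longrightarrow> y \<in> X \<Longrightarrow> x \<noteq> y \<Longrightarrow> s \<le> dist x y"
    "\<And>x. \<exists>y\<in>X. dist x y < 2 * s"
proof -
  obtain K where K: "finite K" "(UNIV :: 'm set) \<subseteq> (\<Union>x\<in>K. ball x s)"
    using assms unfolding compact_eq_totally_bounded by blast
  \<comment> \<open>Searching inside the finite \<open>s\<close>-net \<open>K\<close> guarantees a
    maximal separated set. Maximality puts each point of \<open>K\<close> within \<open>s\<close> of
    it, and the triangle inequality doubles the radius for general points.\<close>
  define \<S> where "\<S> = {X. X \<subseteq> K \<and> (\<forall>x\<in>X. \<forall>y\<in>X. x \<noteq> y \<longrightarrow> s \<le> dist x y)}"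
  have "finite \<S>" "{} \<in> \<S>" using K(1) by (auto simp: \<S>_def)
  then obtain X where X: "X \<in> \<S>" and max: "\<And>Y. Y \<in> \<S> \<Longrightarrow> X \<subseteq> Y \<Longrightarrow> X = Y"
    using finite_has_maximal[of \<S>] by blast
  have near: "\<exists>y\<in>X. dist k y < s" if k: "k \<in> K" for k
  proof (rule ccontr)
    assume "\<not> ?thesis"
    then have far: "\<And>y. y \<in> X \<Longrightarrow> s \<le> dist k y" by (force simp: not_less)
    then have "insert k X \<in> \<S>" using X k by (auto simp: \<S>_def dist_commute)
    then have "k \<in> X" using max by blast
    then show False using far[of k] assms(2) by simp
  qed
  show ?thesis
  proof
    show "finite X" using X K(1) finite_subset by (auto simp: \<S>_def)
    show "s \<le> dist x y" if "x \<in> X" "y \<in> X" "x \<noteq> y" for x y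
      using X that by (auto simp: \<S>_def)
    fix x
    have "x \<in> (\<Union>k\<in>K. ball k s)" using K(2) by blast
    then obtain k where k: "k \<in> K" "dist k x < s" by auto
    obtain y where "y \<in> X" "dist k y < s" using near[OF k(1)] by blast
    then show "\<exists>y\<in>X. dist x y < 2 * s"
      using k(2) dist_triangle[of x y k] by (intro bexI[of _ y]) (auto simp: dist_commute)
  qed
qed

text \<open>Cover members are grouped by a nearby net point, and points within \<open>r\<close> of
  the net are handed over to balls, which yields the separation. The multiplicity
  \<open>d + 2\<close> is \<open>d + 1\<close> from the cover plus one ball.\<close>

lemma exists_nagata_net:
  assumes compact: "compact (UNIV :: 'm::metric_space set)" and r: "0 < r" and \<gamma>: "0 < \<gamma>"
    and cov: "\<Union>\<C> = (UNIV :: 'm::metric_space set)"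
    and small: "\<And>B. B \<in> \<C> \<Longrightarrow> bounded B \<and> diameter B \<le> \<gamma> * (8 * r)"
    and few: "\<And>A. bounded A \<Longrightarrow> diameter A < 8 * r \<Longrightarrow>
        finite {B\<in>\<C>. B \<inter> A \<noteq> {}} \<and> card {B\<in>\<C>. B \<inter> A \<noteq> {}} \<le> d + 1"
  shows "\<exists>X D. nagata_net X (D :: 'm::metric_space \<Rightarrow> 'm set) r (16 + 8 * \<gamma>) (d + 2)"
proof -
  define \<kappa> where "\<kappa> = 16 + 8 * \<gamma>"
  obtain X :: "'m set" where X: "finite X"
    and sep: "\<And>x y. x \<in> X \<Longrightarrow> y \<in> X \<Longrightarrow> x \<noteq> y \<Longrightarrow> 8 * r \<le> dist x y"
    and net: "\<And>x. \<exists>y\<in>X. dist x y < 2 * (8 * r)"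
    using finite_separated_net[OF compact, of "8 * r"] r by auto
  \<comment> \<open>The diameter of \<open>B\<close> contributes \<open>8 * \<gamma> * r\<close> and
    the distance to the net \<open>16 * r\<close>, which together make up
    \<open>\<kappa> * r\<close>.\<close>
  have "\<exists>i\<in>X. \<forall>x\<in>B. dist x i \<le> \<kappa> * r" if B: "B \<in> \<C>" for B
  proof (cases "B = {}")
    case False
    then obtain b where b: "b \<in> B" by blast
    obtain i where i: "i \<in> X" "dist b i < 2 * (8 * r)" using net by blast
    have "dist x i \<le> \<kappa> * r" if "x \<in> B" for x
    proof -
      have "dist x b \<le> \<gamma> * (8 * r)"
        using diameter_bounded_bound[of B x b] small[OF B] that b by linarith
      then show ?thesis using dist_triangle[of x i b] i(2) by (simp add: \<kappa>_def algebra_simps)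
    qed
    with i(1) show ?thesis by blast
  qed (use net in blast)
  then obtain c where c: "\<And>B. B \<in> \<C> \<Longrightarrow> c B \<in> X" "\<And>B x. B \<in> \<C> \<Longrightarrow> x \<in> B \<Longrightarrow> dist x (c B) \<le> \<kappa> * r"
    by metis
  define D where "D i = ball i r \<union> {x. (\<exists>B\<in>\<C>. c B = i \<and> x \<in> B) \<and> (\<forall>j\<in>X. r \<le> dist x j)}" for i
  have "nagata_net X D r \<kappa> (d + 2)"
  proof
    fix x
    show "\<exists>i\<in>X. x \<in> D i"
    proof (cases "\<exists>j\<in>X. dist x j < r")
      case True
      then obtain j where "j \<in> X" "x \<in> ball j r" by (auto simp: dist_commute)
      then show ?thesis unfolding D_def by blast
    next
      case False
      then have "\<forall>j\<in>X. r \<le> dist x j" by (simp add: not_less)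
      moreover have "x \<in> \<Union>\<C>" by (simp add: cov)
      then obtain B where B: "B \<in> \<C>" "x \<in> B" by blast
      ultimately have "x \<in> D (c B)" unfolding D_def by blast
      then show ?thesis using c(1)[OF B(1)] by blast
    qed
    \<comment> \<open>This ball has diameter at most \<open>6 * r\<close>, below the scale
      \<open>8 * r\<close> of the cover, so it meets at most \<open>d + 1\<close> members.\<close>
    define A where "A = ball x (3 * r)"
    have "diameter A \<le> 6 * r"
    proof -
      have "(SUP (y, z)\<in>A \<times> A. dist y z) \<le> 6 * r"
      proof (rule cSUP_least)
        show "A \<times> A \<noteq> {}" using r by (auto simp: A_def)
        fix p assume "p \<in> A \<times> A"
        then show "(case p of (y, z) \<Rightarrow> dist y z) \<le> 6 * r"
          using dist_triangle3[of "fst p" "snd p" x] by (auto simp: A_def)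
      qed
      then show ?thesis using r by (simp add: diameter_def)
    qed
    then have few: "finite {B\<in>\<C>. B \<inter> A \<noteq> {}}" "card {B\<in>\<C>. B \<inter> A \<noteq> {}} \<le> d + 1"
      using few[of A] r by (auto simp: A_def)
    \<comment> \<open>Two points of \<open>J\<close> would be closer than \<open>8 * r\<close>, the
      separation of the net, so there is at most one.\<close>
    define J where "J = {i\<in>X. dist x i < 4 * r}"
    have "i = j" if "i \<in> J" "j \<in> J" for i j
      using sep[of i j] that dist_triangle3[of i j x] by (force simp: J_def)
    moreover have finJ: "finite J" using X by (simp add: J_def)
    ultimately have "card J \<le> 1" by (simp add: card_le_Suc0_iff_eq)
    \<comment> \<open>A point of \<open>D i\<close> within \<open>3 * r\<close> of \<open>x\<close>
      lies either in the ball around \<open>i\<close>, so that \<open>i\<close> is in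
      \<open>J\<close>, or in a member of the cover that meets \<open>A\<close> and is assigned to
      \<open>i\<close>.\<close>
    have "{i\<in>X. infdist x (D i) < 3 * r} \<subseteq> c ` {B\<in>\<C>. B \<inter> A \<noteq> {}} \<union> J"
    proof
      fix i assume "i \<in> {i\<in>X. infdist x (D i) < 3 * r}"
      then have i: "i \<in> X" and lt: "infdist x (D i) < 3 * r" by auto
      have "D i \<noteq> {}" unfolding D_def using centre_in_ball[of i r] r by blast
      then obtain z where z: "z \<in> D i" "dist x z < 3 * r"
        using cInf_lessD[of "dist x ` D i" "3 * r"] lt by (auto simp: infdist_notempty)
      show "i \<in> c ` {B\<in>\<C>. B \<inter> A \<noteq> {}} \<union> J"
      proof (cases "z \<in> ball i r")
        case True
        then have "dist x i < 4 * r" using z(2) dist_triangle[of x i z] by (simp add: dist_commute)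
        then show ?thesis using i by (simp add: J_def)
      next
        case False
        then obtain B where "B \<in> \<C>" "c B = i" "z \<in> B" using z(1) unfolding D_def by blast
        moreover have "z \<in> A" using z(2) by (simp add: A_def)
        ultimately show ?thesis by blast
      qed
    qed
    then have "card {i\<in>X. infdist x (D i) < 3 * r} \<le> card (c ` {B\<in>\<C>. B \<inter> A \<noteq> {}} \<union> J)"
      using few(1) finJ by (intro card_mono) auto
    also have "\<dots> \<le> card (c ` {B\<in>\<C>. B \<inter> A \<noteq> {}}) + card J" by (rule card_Un_le)
    also have "\<dots> \<le> (d + 1) + 1"
      using card_image_le[OF few(1), of c] few(2) \<open>card J \<le> 1\<close> by linarith
    finally show "card {i\<in>X. infdist x (D i) < 3 * r} \<le> d + 2" by simp
  next
    fix i assume "i \<in> X"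
    show "i \<in> D i" using r by (simp add: D_def)
    fix x assume "x \<in> D i"
    then consider "x \<in> ball i r" | B where "B \<in> \<C>" "c B = i" "x \<in> B" unfolding D_def by blast
    then show "dist x i \<le> \<kappa> * r"
    proof cases
      case 1
      moreover have "1 * r \<le> \<kappa> * r" using \<gamma> r by (intro mult_right_mono) (auto simp: \<kappa>_def)
      ultimately show ?thesis by (simp add: dist_commute)
    next
      case 2
      then show ?thesis using c(2) by blast
    qed
  next
    fix i j assume ij: "i \<in> X" "j \<in> X" "i \<noteq> j"
    have "D j \<noteq> {}" unfolding D_def using centre_in_ball[of j r] r by blast
    \<comment> \<open>Points of the ball around \<open>j\<close> are far from \<open>i\<close>
      because the net is \<open>8 * r\<close>-separated; the other points of \<open>D j\<close>
      avoid all balls of radius \<open>r\<close> around the net by construction.\<close>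
    moreover have "r \<le> dist i y" if "y \<in> D j" for y
    proof (cases "y \<in> ball j r")
      case True
      then show ?thesis using sep[OF ij] dist_triangle[of i j y] r by (simp add: dist_commute)
    next
      case False
      then have "\<forall>k\<in>X. r \<le> dist y k" using that unfolding D_def by blast
      then show ?thesis using ij(1) by (simp add: dist_commute)
    qed
    ultimately show "r \<le> infdist i (D j)"
      unfolding infdist_notempty[OF \<open>D j \<noteq> {}\<close>] by (intro cINF_greatest) auto
  qed (fact compact X r)+
  then show ?thesis unfolding \<kappa>_def by (intro exI)
qed

theorem theorem4p4:
  assumes "compact (UNIV :: 'm::metric_space set)"
    and "finite_nagata_dimension TYPE('m)"
  shows "has_acug_structure TYPE('m) TYPE(ell2) \<and>
    (\<exists>C>0. \<forall>\<epsilon>>0. \<exists>H (\<Phi> :: ('m \<Rightarrow> real) \<Rightarrow> ('m \<Rightarrow>\<^sub>C (ell2 \<Rightarrow>\<^sub>L real))).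
       acug_pair C \<epsilon> H \<Phi> \<and> \<Phi> ` H \<subseteq> Lip_ell2)"
proof -
  obtain d :: nat and \<gamma> :: real where \<gamma>: "0 < \<gamma>" and nag: "\<forall>s>0. \<exists>\<C> :: 'm set set.
         \<Union>\<C> = UNIV \<and> (\<forall>B\<in>\<C>. bounded B \<and> diameter B \<le> \<gamma> * s) \<and>
         (\<forall>A. bounded A \<and> diameter A < s \<longrightarrow>
            finite {B\<in>\<C>. B \<inter> A \<noteq> {}} \<and> card {B\<in>\<C>. B \<inter> A \<noteq> {}} \<le> d + 1)"
    using assms(2) unfolding finite_nagata_dimension_def by (elim exE conjE)
  define \<kappa> where "\<kappa> = 16 + 8 * \<gamma>"
  define C where "C = net_const \<kappa> (d + 2)"
  have pair: "\<exists>H (\<Phi> :: ('m \<Rightarrow> real) \<Rightarrow> ('m \<Rightarrow>\<^sub>C (ell2 \<Rightarrow>\<^sub>L real))). acug_pair C \<epsilon> H \<Phi> \<and> \<Phi> ` H \<subseteq> Lip_ell2"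
    if \<epsilon>: "0 < \<epsilon>" for \<epsilon>
  proof -
    \<comment> \<open>The scale at which the interpolation error is exactly
      \<open>\<epsilon>\<close>; \<open>C\<close> was fixed beforehand from \<open>\<gamma>\<close>
      and \<open>d\<close> alone.\<close>
    define r where "r = \<epsilon> / (\<kappa> + 3)"
    have r: "0 < r" "(\<kappa> + 3) * r \<le> \<epsilon>" using \<epsilon> \<gamma> by (auto simp: r_def \<kappa>_def)
    obtain \<C> :: "'m set set" where \<C>: "\<Union>\<C> = UNIV"
      "\<And>B. B \<in> \<C> \<Longrightarrow> bounded B \<and> diameter B \<le> \<gamma> * (8 * r)"
      "\<And>A. bounded A \<Longrightarrow> diameter A < 8 * r \<Longrightarrow>
            finite {B\<in>\<C>. B \<inter> A \<noteq> {}} \<and> card {B\<in>\<C>. B \<inter> A \<noteq> {}} \<le> d + 1"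
      using nag[rule_format, of "8 * r"] r(1) by auto
    obtain X and D :: "'m \<Rightarrow> 'm set" where "nagata_net X D r \<kappa> (d + 2)"
      using exists_nagata_net[OF assms(1) r(1) \<gamma> \<C>] unfolding \<kappa>_def by blast
    from nagata_net.exists_acug_pair[OF this r(2)] show ?thesis unfolding C_def .
  qed
  have "0 < C" using \<gamma> by (simp add: C_def net_const_def \<kappa>_def)
  with pair show ?thesis unfolding has_acug_structure_def by blast
qed

end
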